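(* Let $n_1,n_2$ be distinct odd primes with $\gcd(n_1-1,n_2-1)=6$, $n=n_1n_2$, $e=(n_1-1)(n_2-1)/6$, and let $D_0,\dots,D_5$ be the Whiteman generalized cyclotomic classes of order 6 modulo $n$ (see context). Let $q$ be a prime power with $\gcd(q,n)=1$ and $q\bmod n\in D_0$. For $0\le j\le 5$, let $\boldsymbol{C_{n_1,n_2,j}}$ be the cyclic code of length $n$ over $\mathrm{GF}(q)$ generated by $g_{n_1,n_2,j}(x)=\frac{(x^n-1)(x-1)}{(x^{n_1}-1)(x^{n_2}-1)d_j(x)}$. Then $\boldsymbol{C_{n_1,n_2,j}}$ has dimension $n_1+n_2-1+\frac{(n_1-1)(n_2-1)}{6}$ and minimum distance $d_{n_1,n_2,j}\ge\lceil\sqrt{\min(n_1,n_2)}\,\rceil$.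
   Context: Let $g$ be a common primitive root of $n_1$ and $n_2$, $u$ an integer with $u\equiv g\pmod{n_1}$, $u\equiv 1\pmod{n_2}$, and $D_i=\{g^su^i\bmod n: s=0,\dots,e-1\}$ for $i=0,\dots,5$; these partition $\mathbb{Z}_n^*$. Let $m$ be the order of $q$ modulo $n$, $\alpha$ a primitive element of $\mathrm{GF}(q^m)$, $\beta=\alpha^{(q^m-1)/n}$, and $d_j(x)=\prod_{k\in D_j}(x-\beta^k)$. When $q\bmod n\in D_0$, each $d_j(x)$ has coefficients in $\mathrm{GF}(q)$. *)

theory Defs
  imports "HOL-Computational_Algebra.Computational_Algebra" "HOL-Number_Theory.Residue_Primitive_Roots"
begin

definition whiteman_class :: "nat \<Rightarrow> nat \<Rightarrow> nat \<Rightarrow> int \<Rightarrow> nat \<Rightarrow> int set" where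
  "whiteman_class n1 n2 g u i =
     {(int g ^ s * u ^ i) mod int (n1 * n2) | s. s < (n1 - 1) * (n2 - 1) div 6}"

definition d_ext :: "nat \<Rightarrow> nat \<Rightarrow> nat \<Rightarrow> int \<Rightarrow> 'b::field \<Rightarrow> nat \<Rightarrow> 'b poly" where
  "d_ext n1 n2 g u \<beta> j = (\<Prod>k\<in>whiteman_class n1 n2 g u j. [:- (\<beta> ^ nat k), 1:])"

text \<open>The same polynomial regarded over the subfield GF(q), embedded into 'b via emb
  (its coefficients lie in GF(q)).\<close>
definition d_poly :: "('a::field \<Rightarrow> 'b::field) \<Rightarrow> nat \<Rightarrow> nat \<Rightarrow> nat \<Rightarrow> int \<Rightarrow> 'b \<Rightarrow> nat \<Rightarrow> 'a poly" where
  "d_poly emb n1 n2 g u \<beta> j = (THE p. map_poly emb p = d_ext n1 n2 g u \<beta> j)"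

definition xn1 :: "nat \<Rightarrow> 'a::comm_ring_1 poly" where
  "xn1 n = Polynomial.monom 1 n - 1"

text \<open>Cyclic code of length n generated by g: the ideal generated by g in F[x]/(x^n-1),
  codewords represented by polynomials of degree < n.\<close>
definition cyclic_code :: "nat \<Rightarrow> 'a::field poly \<Rightarrow> 'a poly set" where
  "cyclic_code n gen = {(a * gen) mod xn1 n | a. True}"

definition hamming_dist :: "nat \<Rightarrow> 'a::zero poly \<Rightarrow> 'a poly \<Rightarrow> nat" where
  "hamming_dist n c c' = card {i. i < n \<and> Polynomial.coeff c i \<noteq> Polynomial.coeff c' i}"

definition min_distance :: "nat \<Rightarrow> 'a::zero poly set \<Rightarrow> nat" where
  "min_distance n C = Min {hamming_dist n c c' | c c'. c \<in> C \<and> c' \<in> C \<and> c \<noteq> c'}"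

definition code_dim :: "'a::field poly set \<Rightarrow> nat" where
  "code_dim C = vector_space.dim Polynomial.smult C"

end

theory Submission
  imports Defs
begin

text \<open>
  Identify codewords with their coefficient words on \<open>\<int>/n\<close> and evaluate them at the powers of \<open>\<beta>\<close>.
  The class \<open>D\<^sub>j\<close> is a coset of \<open>D\<^sub>0 = \<langle>g\<rangle>\<close>, so for a unit \<open>r\<close> outside \<open>D\<^sub>0\<close> the product
  \<open>c(x) c(x^r)\<close> of a codeword with its dilation vanishes at \<open>\<beta>^k\<close> for every unit \<open>k\<close>. A nonzero word with
  that property has weight at least \<open>min n\<^sub>1 n\<^sub>2\<close>, while the product has weight at most the square of
  the weight \<open>w\<close> of \<open>c\<close>. The product may vanish for an unlucky \<open>r\<close> (in particular when \<open>c\<close> is zero at all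
  non-units), but if \<open>w\<^sup>2 < min n\<^sub>1 n\<^sub>2\<close> then a counting argument modulo \<open>n\<^sub>1\<close> and modulo \<open>n\<^sub>2\<close> yields an
  \<open>r\<close> for which the coefficient at \<open>i\<^sub>0 + r i\<^sub>0\<close>, with \<open>i\<^sub>0\<close> a fixed support position of \<open>c\<close>, receives the
  single contribution \<open>c\<^bsub>i\<^sub>0\<^esub>\<^sup>2 \<noteq> 0\<close>.
\<close>


subsection \<open>Words vanishing at all units\<close>

lemma sum_periodic_shift:
  fixes h :: "nat \<Rightarrow> 'b::comm_monoid_add"
  assumes "\<And>s. h (s + n) = h s"
  shows "(\<Sum>s<n. h (s + a)) = (\<Sum>s<n. h s)"
proof (induction a)
  case (Suc a)
  have "(\<Sum>s<n. h (Suc s + a)) = (\<Sum>s<n. h (s + a))"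
  proof (cases n)
    case (Suc m)
    have "h (Suc m + a) = h a" using assms[of a] Suc by (simp add: add.commute)
    then show ?thesis using Suc
      by (simp only: sum.lessThan_Suc_shift[of "\<lambda>s. h (s + a)"] sum.lessThan_Suc[of "\<lambda>s. h (Suc s + a)"])
        (simp add: add.commute)
  qed auto
  with Suc.IH show ?case by simp
qed simp

lemma inj_on_powers:
  fixes \<beta> :: "'b::field"
  assumes \<beta>: "\<And>k. \<beta> ^ k = 1 \<longleftrightarrow> n dvd k" and "n > 0"
  shows "inj_on (\<lambda>k. \<beta> ^ k) {..<n}"
proof (rule linorder_inj_onI)
  fix a b :: nat assume ab: "a < b" "a \<in> {..<n}" "b \<in> {..<n}"
  have "\<beta> \<noteq> 0" using \<beta>[of n] \<open>n > 0\<close> by (auto simp: zero_power)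
  show "\<beta> ^ a \<noteq> \<beta> ^ b"
  proof
    assume "\<beta> ^ a = \<beta> ^ b"
    then have "\<beta> ^ (b - a) = 1" using ab \<open>\<beta> \<noteq> 0\<close> by (simp add: power_diff)
    then have "n dvd b - a" using \<beta> by simp
    then show False using ab by (auto dest: dvd_imp_le)
  qed
qed auto

text \<open>The word is the coefficient sequence of a polynomial of degree below \<open>n\<close>
  that has the \<open>n\<close> distinct roots \<open>\<beta> ^ k\<close>.\<close>

lemma dft_eq_0_imp_eq_0:
  fixes \<beta> :: "'b::field" and p :: "nat \<Rightarrow> 'b"
  assumes \<beta>: "\<And>k. \<beta> ^ k = 1 \<longleftrightarrow> n dvd k"
    and 0: "\<And>k. k < n \<Longrightarrow> (\<Sum>s<n. p s * \<beta> ^ (s * k)) = 0"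
    and "s < n"
  shows "p s = 0"
proof -
  define P where "P = (\<Sum>s<n. Polynomial.monom (p s) s)"
  have coeff: "Polynomial.coeff P i = (if i < n then p i else 0)" for i
    by (simp add: P_def coeff_sum sum.delta)
  have inj: "inj_on (\<lambda>k. \<beta> ^ k) {..<n}" using inj_on_powers[OF \<beta>] \<open>s < n\<close> by simp
  have "P = 0"
  proof (rule ccontr)
    assume "P \<noteq> 0"
    have "(\<lambda>k. \<beta> ^ k) ` {..<n} \<subseteq> {x. poly P x = 0}"
      using 0 by (auto simp: P_def poly_sum poly_monom power_mult[symmetric] mult.commute)
    then have "card ((\<lambda>k. \<beta> ^ k) ` {..<n}) \<le> card {x. poly P x = 0}"
      using poly_roots_finite[OF \<open>P \<noteq> 0\<close>] by (intro card_mono) auto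
    also have "\<dots> \<le> degree P" by (rule card_poly_roots_bound[OF \<open>P \<noteq> 0\<close>])
    finally have "n \<le> degree P" using inj by (simp add: card_image)
    then have "Polynomial.coeff P (degree P) = 0" by (simp add: coeff)
    with \<open>P \<noteq> 0\<close> show False by simp
  qed
  with coeff[of s] \<open>s < n\<close> show ?thesis by simp
qed

text \<open>Vanishing at the units forces the mixed difference with steps \<open>n1\<close> and
  \<open>n2\<close> to be zero. If the weight were below both primes, some residue class modulo each
  prime would miss the support; propagating these zeros along the two steps kills the whole
  word.\<close>

lemma weight_ge_min_if_vanish_on_units:
  fixes \<beta> :: "'b::field" and p :: "nat \<Rightarrow> 'b"
  assumes \<beta>: "\<And>k. \<beta> ^ k = 1 \<longleftrightarrow> n1 * n2 dvd k"
    and pr: "prime n1" "prime n2" "n1 \<noteq> n2"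
    and 0: "\<And>k. coprime k (n1 * n2) \<Longrightarrow> (\<Sum>s<n1 * n2. p s * \<beta> ^ (s * k)) = 0"
    and nz: "s0 < n1 * n2" "p s0 \<noteq> 0"
  shows "min n1 n2 \<le> card {s. s < n1 * n2 \<and> p s \<noteq> 0}"
proof (rule ccontr)
  define n where "n = n1 * n2"
  define S where "S = {s. s < n \<and> p s \<noteq> 0}"
  assume "\<not> ?thesis"
  then have card: "card S < n1" "card S < n2" by (auto simp: S_def n_def)
  have [simp]: "finite S" by (simp add: S_def)
  have npos: "n > 0" "n1 > 0" "n2 > 0" using pr by (auto simp: n_def prime_gt_0_nat)
  have cop: "coprime n1 n2" using pr by (simp add: primes_coprime)
  have "\<beta> \<noteq> 0" using \<beta>[of 0] \<beta>[of n] npos by (auto simp: zero_power n_def)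
  \<comment> \<open>The periodic extension, so that shifts need no reduction modulo
    \<open>n\<close>.\<close>
  define p' where "p' s = p (s mod n)" for s
  define F where "F k = (\<Sum>s<n. p' s * \<beta> ^ (s * k))" for k
  have F: "F k = (\<Sum>s<n. p s * \<beta> ^ (s * k))" for k
    unfolding F_def by (rule sum.cong) (auto simp: p'_def)
  have bn: "\<beta> ^ (n * k) = 1" for k using \<beta> by (simp add: n_def)
  have shift: "\<beta> ^ (a * k) * (\<Sum>s<n. p' (s + a) * \<beta> ^ (s * k)) = F k" for a k
  proof -
    have "(\<Sum>s<n. p' (s + a) * \<beta> ^ ((s + a) * k)) = F k" unfolding F_def
      by (rule sum_periodic_shift) (simp add: p'_def add_mult_distrib power_add bn)
    then show ?thesis by (simp add: sum_distrib_left algebra_simps power_add)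
  qed
  have Fz: "F k * ((1 - \<beta> ^ (n1 * k)) * (1 - \<beta> ^ (n2 * k))) = 0" for k
  proof (cases "coprime k n")
    case True
    then show ?thesis using 0 F by (simp add: n_def)
  next
    case False
    then have "n1 dvd k \<or> n2 dvd k"
      using pr prime_imp_coprime_nat by (metis coprime_commute coprime_mult_right_iff n_def)
    then have "\<beta> ^ (n2 * k) = 1 \<or> \<beta> ^ (n1 * k) = 1" by (auto simp: \<beta> elim!: dvdE)
    then show ?thesis by auto
  qed
  \<comment> \<open>The transform of this mixed difference is that of \<open>p\<close> times
    \<open>(1 - \<beta> ^ (n1 * k)) * (1 - \<beta> ^ (n2 * k))\<close>, up to a unit; the factor is \<open>0\<close> at every non-unit \<open>k\<close>.\<close>
  define d where "d s = p' (s + n1 + n2) - p' (s + n2) - (p' (s + n1) - p' s)" for s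
  have d0: "d s = 0" if "s < n" for s
  proof (rule dft_eq_0_imp_eq_0[OF _ _ that])
    show "\<beta> ^ k = 1 \<longleftrightarrow> n dvd k" for k using \<beta> by (simp add: n_def)
    fix k
    have "\<beta> ^ ((n1 + n2) * k) * (\<Sum>s<n. d s * \<beta> ^ (s * k)) =
        \<beta> ^ ((n1 + n2) * k) * (\<Sum>s<n. p' (s + (n1 + n2)) * \<beta> ^ (s * k))
        - \<beta> ^ (n1 * k) * (\<beta> ^ (n2 * k) * (\<Sum>s<n. p' (s + n2) * \<beta> ^ (s * k)))
        - \<beta> ^ (n2 * k) * (\<beta> ^ (n1 * k) * (\<Sum>s<n. p' (s + n1) * \<beta> ^ (s * k)))
        + \<beta> ^ (n1 * k) * \<beta> ^ (n2 * k) * (\<Sum>s<n. p' s * \<beta> ^ (s * k))"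
      by (simp add: d_def sum_subtractf sum.distrib algebra_simps power_add)
    also have "\<dots> = F k * ((1 - \<beta> ^ (n1 * k)) * (1 - \<beta> ^ (n2 * k)))"
      unfolding shift by (simp add: F_def[symmetric] algebra_simps)
    finally show "(\<Sum>s<n. d s * \<beta> ^ (s * k)) = 0" using Fz \<open>\<beta> \<noteq> 0\<close> by simp
  qed
  have d0': "p' (s + n2 + n1) - p' (s + n2) = p' (s + n1) - p' s" for s
  proof -
    have "d s = d (s mod n)" unfolding d_def p'_def add.assoc by (simp add: mod_simps)
    then show ?thesis using d0[of "s mod n"] npos by (simp add: d_def add_ac)
  qed
  have ex: "\<exists>i<m. \<forall>s. s mod m = i \<longrightarrow> p' s = 0" if "card S < m" "m dvd n" for m
  proof -
    have "card ((\<lambda>s. s mod m) ` S) < card {..<m}"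
      using that card_image_le[of S "\<lambda>s. s mod m"] by simp
    then obtain i where i: "i < m" "i \<notin> (\<lambda>s. s mod m) ` S"
      by (metis card_mono finite_imageI \<open>finite S\<close> lessThan_iff not_less subsetI)
    have "p' s = 0" if "s mod m = i" for s
    proof (rule ccontr)
      assume "p' s \<noteq> 0"
      then have "s mod n \<in> S" using npos by (auto simp: S_def p'_def)
      then have "(s mod n) mod m \<in> (\<lambda>s. s mod m) ` S" by blast
      then show False using i that \<open>m dvd n\<close> by (simp add: mod_mod_cancel)
    qed
    with i show ?thesis by blast
  qed
  have reach: "\<exists>t. (s + t * b) mod a = i" if ab: "coprime a b" and "i < a" for s a b i :: nat
  proof -
    obtain x where "[b * x = 1] (mod a)" using cong_solve_coprime_nat[of b a] ab by (auto simp: coprime_commute)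
    \<comment> \<open>The multiplier is \<open>x * (i - s)\<close> for the inverse \<open>x\<close>
      of \<open>b\<close> modulo \<open>a\<close>; \<open>(a - 1) * s\<close> stands for
      \<open>- s\<close> among the naturals.\<close>
    then have "[s + (x * (i + (a - 1) * s)) * b = s + 1 * (i + (a - 1) * s)] (mod a)"
      by (intro cong_add cong_refl) (metis cong_scalar_right mult.assoc mult.commute)
    also have "s + 1 * (i + (a - 1) * s) = i + a * s" using \<open>i < a\<close> by (cases a) auto
    finally show ?thesis using \<open>i < a\<close> by (auto simp: cong_def)
  qed
  obtain i where i: "i < n1" "\<And>s. s mod n1 = i \<Longrightarrow> p' s = 0" using ex[of n1] card by (auto simp: n_def)
  obtain j where j: "j < n2" "\<And>s. s mod n2 = j \<Longrightarrow> p' s = 0" using ex[of n2] card by (auto simp: n_def)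
  have step1: "p' (s + t * n2 + n1) - p' (s + t * n2) = p' (s + n1) - p' s" for s t
    by (induction t) (use d0'[of "s + _ * n2"] in \<open>auto simp: add_ac\<close>)
  \<comment> \<open>\<open>step1\<close> moves the difference into the empty class \<open>i\<close>
    modulo \<open>n1\<close>; adding \<open>n1\<close> stays in that class, so both terms are zero
    there.\<close>
  have eq: "p' (s + n1) = p' s" for s
  proof -
    obtain t where t: "(s + t * n2) mod n1 = i" using reach[OF cop i(1)] by blast
    then show ?thesis using step1[of s t] i(2)[of "s + t * n2"] i(2)[of "s + t * n2 + n1"] by simp
  qed
  have step2: "p' (s + t * n1) = p' s" for s t
    by (induction t) (use eq[of "s + _ * n1"] in \<open>auto simp: add_ac\<close>)
  obtain t where "(s0 + t * n1) mod n2 = j" using reach[OF _ j(1)] cop coprime_commute by metis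
  then have "p' s0 = 0" using step2[of s0 t] j(2) by simp
  then show False using nz by (simp add: p'_def n_def)
qed


subsection \<open>Separating dilations\<close>

lemma coprime_less_prime:
  fixes p x :: nat
  assumes "prime p" "x \<in> {1..<p}"
  shows "coprime x p"
  using assms prime_imp_coprime[of p x] nat_dvd_not_less[of x p] by (auto simp: coprime_commute)

text \<open>For fixed \<open>i\<close> and \<open>i'\<close> the congruence is linear in
  \<open>x\<close> with slope \<open>i' - i0\<close>, invertible modulo \<open>p\<close>, so it has
  at most one solution. For \<open>i = i0\<close> that solution is 0, outside the range, hence the
  factor \<open>card I - 1\<close>.\<close>

lemma card_collision_residues_le:
  fixes p :: nat
  assumes p: "prime p" and fin: "finite I" and i0: "i0 \<in> I"
    and A: "A \<subseteq> I" "\<And>i'. i' \<in> A \<Longrightarrow> \<not> [i' = i0] (mod p)"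
  shows "card {x \<in> {1..<p}. \<exists>i\<in>I. \<exists>i'\<in>A. [i + x * i' = i0 + x * i0] (mod p)}
           \<le> (card I - 1) * card A"
proof -
  define T where "T i i' = {x \<in> {1..<p}. [i + x * i' = i0 + x * i0] (mod p)}" for i i'
  have finA: "finite A" using A fin finite_subset by blast
  have T1: "card (T i i') \<le> 1" if "i' \<in> A" for i i'
  proof -
    have "x = y" if xy: "x \<in> T i i'" "y \<in> T i i'" for x y
    proof -
      have "int p dvd int (i + x * i') - int (i0 + x * i0)" "int p dvd int (i + y * i') - int (i0 + y * i0)"
        using xy by (simp_all add: T_def cong_iff_dvd_diff flip: cong_int_iff)
      then have "int p dvd (int (i + x * i') - int (i0 + x * i0)) - (int (i + y * i') - int (i0 + y * i0))"
        by (rule dvd_diff)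
      also have "\<dots> = (int x - int y) * (int i' - int i0)" by (simp add: algebra_simps)
      finally have "int p dvd int x - int y \<or> int p dvd int i' - int i0"
        using p by (simp add: prime_dvd_mult_iff)
      with A(2)[OF \<open>i' \<in> A\<close>] have "int p dvd int x - int y"
        by (simp add: cong_iff_dvd_diff flip: cong_int_iff)
      then have "[x = y] (mod p)" by (simp add: cong_iff_dvd_diff flip: cong_int_iff)
      with xy show ?thesis by (auto simp: T_def cong_def)
    qed
    then show ?thesis by (intro card_le_Suc0_iff_eq[THEN iffD2, unfolded One_nat_def[symmetric]])
        (auto simp: T_def)
  qed
  have T0: "T i0 i' = {}" if "i' \<in> A" for i'
  proof -
    have False if x: "x \<in> T i0 i'" for x
    proof -
      have "[x * i' = x * i0] (mod p)" using x by (simp add: T_def cong_add_lcancel_nat)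
      moreover have "coprime x p" using x p by (intro coprime_less_prime) (auto simp: T_def)
      ultimately show False using A(2)[OF \<open>i' \<in> A\<close>] by (simp add: cong_mult_lcancel_nat)
    qed
    then show ?thesis by blast
  qed
  have "{x \<in> {1..<p}. \<exists>i\<in>I. \<exists>i'\<in>A. [i + x * i' = i0 + x * i0] (mod p)}
      = (\<Union>(i, i') \<in> (I - {i0}) \<times> A. T i i')"
    using T0 by (fastforce simp: T_def)
  also have "card \<dots> \<le> (\<Sum>(i, i') \<in> (I - {i0}) \<times> A. card (T i i'))"
    using card_UN_le[of "(I - {i0}) \<times> A" "\<lambda>(i,i'). T i i'"] fin finA by (simp add: case_prod_unfold)
  also have "\<dots> \<le> (\<Sum>_ \<in> (I - {i0}) \<times> A. 1)" using T1 by (intro sum_mono) auto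
  also have "\<dots> = (card I - 1) * card A" using i0 by (simp add: card_cartesian_product)
  finally show ?thesis .
qed

text \<open>If \<open>y\<close> is a power of \<open>g\<close> at all, this fixes the exponent
  modulo \<open>p' - 1\<close>, hence modulo 6, and one sixth of the exponents modulo
  \<open>p - 1\<close> lie in a given class modulo 6.\<close>

lemma card_slice_cyclic_subgroup_le:
  fixes p p' g y :: nat
  assumes p: "prime p" "prime p'" "6 dvd p - 1" "6 dvd p' - 1"
    and g: "residue_primroot p g" "residue_primroot p' g"
  shows "6 * card {x \<in> {1..<p}. \<exists>s. [x = g ^ s] (mod p) \<and> [y = g ^ s] (mod p')} \<le> p - 1"
proof (cases "\<exists>s. [y = g ^ s] (mod p')")
  case True
  then obtain s0 where s0: "[y = g ^ s0] (mod p')" by blast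
  obtain m where m: "p - 1 = 6 * m" using p by blast
  have mpos: "m > 0" using m prime_gt_1_nat[OF p(1)] by (intro gr0I) auto
  have sub: "{x \<in> {1..<p}. \<exists>s. [x = g ^ s] (mod p) \<and> [y = g ^ s] (mod p')}
      \<subseteq> (\<lambda>t. g ^ (6 * t + s0 mod 6) mod p) ` {..<m}"
  proof safe
    fix x s assume x: "x \<in> {1..<p}" "[x = g ^ s] (mod p)" "[y = g ^ s] (mod p')"
    have "[g ^ s = g ^ s0] (mod p')" using cong_trans[OF cong_sym[OF x(3)] s0] .
    moreover have "coprime p' g" "ord p' g = p' - 1"
      using g(2) p(2) by (simp_all add: residue_primroot_def totient_prime)
    ultimately have "[s = s0] (mod p' - 1)" using order_divides_expdiff by metis
    then have "[s = s0] (mod 6)" using p(4) by (rule cong_dvd_modulus_nat)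
    define r where "r = s mod (p - 1)"
    have "r mod 6 = s0 mod 6" using \<open>[s = s0] (mod 6)\<close> p(3) by (simp add: r_def cong_def mod_mod_cancel)
    then have r: "r = 6 * (r div 6) + s0 mod 6" by (metis mult_div_mod_eq)
    have "r < 6 * m" using m mpos by (simp add: r_def)
    then have "r div 6 \<in> {..<m}" by (simp add: div_less_iff_less_mult mult.commute)
    have "coprime p g" "ord p g = p - 1"
      using g(1) p(1) by (simp_all add: residue_primroot_def totient_prime)
    moreover have "[s = r] (mod p - 1)" by (simp add: r_def cong_def)
    ultimately have "[g ^ s = g ^ r] (mod p)" using order_divides_expdiff by metis
    then have "x = g ^ r mod p" using x by (simp add: cong_def)
    then show "x \<in> (\<lambda>t. g ^ (6 * t + s0 mod 6) mod p) ` {..<m}"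
      using \<open>r div 6 \<in> _\<close> by (intro image_eqI[where x = "r div 6"]) (simp_all flip: r)
  qed
  have "card {x \<in> {1..<p}. \<exists>s. [x = g ^ s] (mod p) \<and> [y = g ^ s] (mod p')} \<le> m"
    using surj_card_le[OF _ sub] by simp
  then show ?thesis using m by simp
qed auto

text \<open>\<open>y\<close> is chosen first, outside \<open>Y\<close>. Then \<open>x\<close> has to
  avoid \<open>X\<close>, whose size is below five sixths of \<open>n1 - 1\<close>, and the powers
  of \<open>g\<close> lying over \<open>y\<close>, which take at most one sixth.\<close>

lemma exists_unit_pair_avoiding:
  fixes g :: nat
  assumes p: "prime n1" "prime n2" "6 dvd n1 - 1" "6 dvd n2 - 1"
    and g: "residue_primroot n1 g" "residue_primroot n2 g"
    and Y: "finite Y" "card Y < n2 - 1" and X: "finite X" "6 * card X < 5 * (n1 - 1)"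
  shows "\<exists>x y. x \<in> {1..<n1} - X \<and> y \<in> {1..<n2} - Y \<and>
               \<not> (\<exists>s. [x = g ^ s] (mod n1) \<and> [y = g ^ s] (mod n2))"
proof -
  have "\<not> {1..<n2} \<subseteq> Y" using Y card_mono[of Y "{1..<n2}"] by auto
  then obtain y where y: "y \<in> {1..<n2} - Y" by blast
  let ?H = "{x \<in> {1..<n1}. \<exists>s. [x = g ^ s] (mod n1) \<and> [y = g ^ s] (mod n2)}"
  have "6 * card (X \<union> ?H) \<le> 6 * card X + 6 * card ?H" using card_Un_le[of X ?H] by simp
  also have "\<dots> < 6 * (n1 - 1)"
    using card_slice_cyclic_subgroup_le[OF p g, of y] X by linarith
  finally have "card (X \<union> ?H) < card {1..<n1}" by simp
  then have "\<not> {1..<n1} \<subseteq> X \<union> ?H" using X card_mono[of "X \<union> ?H" "{1..<n1}"] by auto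
  with y show ?thesis by blast
qed

text \<open>The last conjunct says that the exponent \<open>i0 + r * i0\<close> comes from the pair
  \<open>(i0, i0)\<close> alone. The two residues of \<open>r\<close> are chosen together and glued
  by the Chinese remainder theorem.\<close>

lemma exists_separating_unit:
  fixes g :: nat
  assumes p: "prime n1" "prime n2" "n1 \<noteq> n2" "6 dvd n1 - 1" "6 dvd n2 - 1"
    and g: "residue_primroot n1 g" "residue_primroot n2 g"
    and I: "I \<subseteq> {..<n1 * n2}" "i0 \<in> I" "card I ^ 2 < min n1 n2"
  shows "\<exists>r. coprime r (n1 * n2) \<and> \<not> (\<exists>s. [r = g ^ s] (mod n1 * n2)) \<and>
             (\<forall>i\<in>I. \<forall>i'\<in>I. [i + r * i' = i0 + r * i0] (mod n1 * n2) \<longrightarrow> i = i0 \<and> i' = i0)"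
proof -
  have finI: "finite I" using I(1) finite_subset by blast
  have cop: "coprime n1 n2" using p by (simp add: primes_coprime)
  define w where "w = card I"
  have w: "w > 0" "w ^ 2 < n1" "w ^ 2 < n2" using I finI by (auto simp: w_def card_gt_0_iff)
  \<comment> \<open>Collisions with \<open>i' \<in> A\<close> are excluded by \<open>r mod n1\<close>, those with \<open>i' \<in> B\<close> by \<open>r mod n2\<close>. Since
    \<open>card A + card B = card I - 1\<close>, at most one of the two exclusion sets exceeds half of \<open>min n1 n2\<close>,
    which leaves room to avoid \<open>\<langle>g\<rangle>\<close> in the other component.\<close>
  define A where "A = {i' \<in> I. i' \<noteq> i0 \<and> [i' = i0] (mod n2)}"
  define B where "B = {i' \<in> I. \<not> [i' = i0] (mod n2)}"
  define X where "X = {x \<in> {1..<n1}. \<exists>i\<in>I. \<exists>i'\<in>A. [i + x * i' = i0 + x * i0] (mod n1)}"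
  define Y where "Y = {x \<in> {1..<n2}. \<exists>i\<in>I. \<exists>i'\<in>B. [i + x * i' = i0 + x * i0] (mod n2)}"
  have eqI: "i = i0" if "i \<in> I" "[i = i0] (mod n1 * n2)" for i
  proof -
    have "i < n1 * n2" "i0 < n1 * n2" using that I by auto
    then show ?thesis using that(2) by (simp add: cong_def)
  qed
  have "card A + card B = card (A \<union> B)" using finI by (intro card_Un_disjoint[symmetric]) (auto simp: A_def B_def)
  also have "A \<union> B = I - {i0}" by (auto simp: A_def B_def)
  finally have AB: "card A + card B = w - 1" using I finI by (simp add: w_def)
  have cX: "card X \<le> (w - 1) * card A" unfolding X_def w_def
  proof (rule card_collision_residues_le[OF p(1) finI I(2)])
    fix i' assume i': "i' \<in> A"
    then have "\<not> [i' = i0] (mod n1 * n2)" using eqI by (auto simp: A_def)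
    then show "\<not> [i' = i0] (mod n1)" using i' cop by (auto simp: A_def intro: coprime_cong_mult_nat)
  qed (auto simp: A_def)
  have cY: "card Y \<le> (w - 1) * card B" unfolding Y_def w_def
    by (rule card_collision_residues_le[OF p(2) finI I(2)]) (auto simp: B_def)
  have "(w - 1) * card A + (w - 1) * card B = (w - 1) ^ 2"
    using AB by (simp add: power2_eq_square flip: add_mult_distrib2)
  \<comment> \<open>The slack of 2 comes from \<open>w > 0\<close>, which gives
    \<open>(w - 1) ^ 2 + 1 \<le> w ^ 2\<close>, and from the strict bound on
    \<open>w ^ 2\<close>.\<close>
  moreover have "(w - 1) ^ 2 + 2 \<le> min n1 n2"
  proof -
    obtain v where "w = Suc v" using w by (cases w) auto
    then show ?thesis using w by (simp add: power2_eq_square)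
  qed
  ultimately have sum: "card X + card Y + 2 \<le> min n1 n2" using cX cY by linarith
  have "\<exists>x y. x \<in> {1..<n1} - X \<and> y \<in> {1..<n2} - Y \<and>
               \<not> (\<exists>s. [x = g ^ s] (mod n1) \<and> [y = g ^ s] (mod n2))"
  \<comment> \<open>The prime with the larger exclusion set is served first, since that choice needs
    only one free residue.\<close>
  proof (cases "card X \<le> card Y")
    case True
    then have "6 * card X < 5 * (n1 - 1)" "card Y < n2 - 1" using sum by linarith+
    then show ?thesis by (intro exists_unit_pair_avoiding p g) (auto simp: X_def Y_def)
  next
    case False
    then have "6 * card Y < 5 * (n2 - 1)" "card X < n1 - 1" using sum by linarith+
    then have "\<exists>y x. y \<in> {1..<n2} - Y \<and> x \<in> {1..<n1} - X \<and>
               \<not> (\<exists>s. [y = g ^ s] (mod n2) \<and> [x = g ^ s] (mod n1))"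
      by (intro exists_unit_pair_avoiding p g) (auto simp: X_def Y_def)
    then show ?thesis by metis
  qed
  then obtain x y where xy: "x \<in> {1..<n1}" "x \<notin> X" "y \<in> {1..<n2}" "y \<notin> Y"
    "\<not> (\<exists>s. [x = g ^ s] (mod n1) \<and> [y = g ^ s] (mod n2))" by blast
  obtain r where r: "[r = x] (mod n1)" "[r = y] (mod n2)"
    using binary_chinese_remainder_nat[OF cop] by blast
  have coll: "[i + z * i' = i0 + z * i0] (mod m)"
    if "[i + r * i' = i0 + r * i0] (mod n1 * n2)" "[r = z] (mod m)" "m dvd n1 * n2" for i i' z m
  proof -
    have "[i + z * i' = i + r * i'] (mod m)" using that(2) cong_sym by (intro cong_add cong_mult cong_refl) blast
    also have "[i + r * i' = i0 + r * i0] (mod m)" using that(1,3) by (rule cong_dvd_modulus_nat)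
    also have "[i0 + r * i0 = i0 + z * i0] (mod m)" using that(2) by (intro cong_add cong_mult cong_refl)
    finally show ?thesis .
  qed
  have "coprime x n1" "coprime y n2" using xy p by (auto intro: coprime_less_prime)
  then have "coprime r n1" "coprime r n2" using r cong_imp_coprime cong_sym by blast+
  then have "coprime r (n1 * n2)" by simp
  moreover have "\<not> (\<exists>s. [r = g ^ s] (mod n1 * n2))"
  proof
    assume "\<exists>s. [r = g ^ s] (mod n1 * n2)"
    then obtain s where "[r = g ^ s] (mod n1)" "[r = g ^ s] (mod n2)"
      using cong_modulus_mult_nat by (metis mult.commute)
    then show False using xy(5) r cong_sym cong_trans by blast
  qed
  moreover have "i = i0 \<and> i' = i0" if h: "i \<in> I" "i' \<in> I" "[i + r * i' = i0 + r * i0] (mod n1 * n2)" for i i'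
  proof -
    have "i' \<notin> A" using coll[OF h(3) r(1)] xy h by (auto simp: X_def)
    moreover have "i' \<notin> B" using coll[OF h(3) r(2)] xy h by (auto simp: Y_def)
    ultimately have "i' = i0" using h by (auto simp: A_def B_def)
    with h show ?thesis using eqI by (simp add: cong_add_rcancel_nat)
  qed
  ultimately show ?thesis by blast
qed


section \<open>The square-root bound on the weight\<close>

lemma coset_mult_closed_imp_power:
  fixes g v r n k :: nat
  assumes "coprime g n" "coprime v n"
    and "[k = g ^ s * v] (mod n)" "[r * k = g ^ t * v] (mod n)"
  shows "\<exists>i. [r = g ^ i] (mod n)"
proof -
  have "[r * (g ^ s * v) = r * k] (mod n)" using cong_sym[OF assms(3)] by (rule cong_scalar_left)
  then have "[(r * g ^ s) * v = g ^ t * v] (mod n)" using cong_trans[OF _ assms(4)] by (simp add: mult.assoc)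
  then have rg: "[r * g ^ s = g ^ t] (mod n)" using assms(2) by (simp add: cong_mult_rcancel_nat)
  show ?thesis
  \<comment> \<open>For positive \<open>n\<close>, \<open>g ^ ((totient n - 1) * s)\<close> serves
    as the inverse of \<open>g ^ s\<close> by Euler's theorem; modulo 0, congruence is equality and
    coprimality gives \<open>g = 1\<close>.\<close>
  proof (cases "n = 0")
    case True
    then show ?thesis using assms(1) rg by auto
  next
    case False
    then have tot: "totient n > 0" by simp
    have "[(g ^ totient n) ^ s = 1 ^ s] (mod n)"
      by (intro cong_pow euler_theorem assms)
    then have "[r * (g ^ totient n) ^ s = r * 1 ^ s] (mod n)" by (rule cong_scalar_left)
    moreover have "r * (g ^ totient n) ^ s = (r * g ^ s) * g ^ ((totient n - 1) * s)"
      using tot by (cases "totient n") (simp_all add: power_mult power_mult_distrib power_add mult_ac)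
    moreover have "[(r * g ^ s) * g ^ ((totient n - 1) * s) = g ^ t * g ^ ((totient n - 1) * s)] (mod n)"
      using rg by (rule cong_scalar_right)
    ultimately have "[r = g ^ (t + (totient n - 1) * s)] (mod n)"
      by (simp add: power_add cong_def)
    then show ?thesis by blast
  qed
qed

text \<open>Among the units only those in the coset of \<open>v\<close> may carry nonzero transform
  values. The proof is by contradiction because the failure of the bound is what makes a separating
  \<open>r\<close> available.\<close>

lemma min_le_weight_square:
  fixes \<beta> :: "'b::field" and c :: "nat \<Rightarrow> 'b" and g :: nat
  assumes \<beta>: "\<And>k. \<beta> ^ k = 1 \<longleftrightarrow> n1 * n2 dvd k"
    and p: "prime n1" "prime n2" "n1 \<noteq> n2" "6 dvd n1 - 1" "6 dvd n2 - 1"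
    and g: "residue_primroot n1 g" "residue_primroot n2 g"
    and v: "coprime v (n1 * n2)"
    and 0: "\<And>k. coprime k (n1 * n2) \<Longrightarrow> \<not> (\<exists>s. [k = g ^ s * v] (mod n1 * n2)) \<Longrightarrow>
                  (\<Sum>i<n1 * n2. c i * \<beta> ^ (i * k)) = 0"
    and i0: "i0 < n1 * n2" "c i0 \<noteq> 0"
  shows "min n1 n2 \<le> card {i. i < n1 * n2 \<and> c i \<noteq> 0} ^ 2"
proof (rule ccontr)
  define n where "n = n1 * n2"
  define I where "I = {i. i < n \<and> c i \<noteq> 0}"
  assume "\<not> ?thesis"
  then have small: "card I ^ 2 < min n1 n2" by (simp only: I_def n_def not_le)
  have [simp]: "finite I" by (simp add: I_def)
  have npos: "n > 0" using i0 unfolding n_def by (metis less_nat_zero_code not_gr_zero)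
  have "coprime g n" using g by (simp add: n_def residue_primroot_def coprime_commute)
  obtain r where r: "coprime r n" "\<not> (\<exists>s. [r = g ^ s] (mod n))"
    "\<And>i i'. i \<in> I \<Longrightarrow> i' \<in> I \<Longrightarrow> [i + r * i' = i0 + r * i0] (mod n) \<Longrightarrow> i = i0 \<and> i' = i0"
    using exists_separating_unit[OF p g _ _ small] i0 unfolding n_def I_def by blast
  \<comment> \<open>\<open>P s\<close> is the coefficient of \<open>x ^ s\<close> in
    \<open>c(x) c(x^r)\<close> reduced modulo \<open>x ^ n - 1\<close>.\<close>
  define P where "P s = (\<Sum>(i, i') \<in> {z \<in> I \<times> I. (fst z + r * snd z) mod n = s}. c i * c i')" for s
  define F where "F k = (\<Sum>i<n. c i * \<beta> ^ (i * k))" for k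
  have F: "F k = (\<Sum>i\<in>I. c i * \<beta> ^ (i * k))" for k
    unfolding F_def by (rule sum.mono_neutral_right) (auto simp: I_def)
  have modn: "\<beta> ^ (a mod n * k) = \<beta> ^ (a * k)" for a k
  proof -
    have "\<beta> ^ (a * k) = \<beta> ^ (n * (a div n * k) + a mod n * k)"
      by (metis add_mult_distrib mult.assoc mult_div_mod_eq)
    also have "\<dots> = \<beta> ^ (a mod n * k)" using \<beta>[of "n * (a div n * k)"] by (simp add: power_add n_def)
    finally show ?thesis by simp
  qed
  have conv: "(\<Sum>s<n. P s * \<beta> ^ (s * k)) = F k * F (r * k)" for k
  proof -
    have "(\<Sum>s<n. P s * \<beta> ^ (s * k)) =
      (\<Sum>s<n. \<Sum>z \<in> {z \<in> I \<times> I. (fst z + r * snd z) mod n = s}.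
         c (fst z) * c (snd z) * \<beta> ^ ((fst z + r * snd z) * k))"
      unfolding P_def sum_distrib_right case_prod_unfold
    proof (intro sum.cong refl)
      fix s z assume "z \<in> {z \<in> I \<times> I. (fst z + r * snd z) mod n = s}"
      then show "c (fst z) * c (snd z) * \<beta> ^ (s * k) = c (fst z) * c (snd z) * \<beta> ^ ((fst z + r * snd z) * k)"
        using modn[of "fst z + r * snd z" k] by simp
    qed
    also have "\<dots> = (\<Sum>z \<in> I \<times> I. c (fst z) * c (snd z) * \<beta> ^ ((fst z + r * snd z) * k))"
      using npos by (intro sum.group) auto
    also have "\<dots> = F k * F (r * k)"
      unfolding F sum_product sum.cartesian_product
      by (intro sum.cong) (auto simp: algebra_simps power_add)
    finally show ?thesis .
  qed
  \<comment> \<open>Since \<open>r\<close> is not a power of \<open>g\<close>, \<open>k\<close> and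
    \<open>r * k\<close> cannot both lie in the coset of \<open>v\<close>, so one of the two factors
    in \<open>conv\<close> is zero.\<close>
  have "(\<Sum>s<n1 * n2. P s * \<beta> ^ (s * k)) = 0" if k: "coprime k (n1 * n2)" for k
  proof (cases "\<exists>s. [k = g ^ s * v] (mod n)")
    case True
    then have "\<not> (\<exists>t. [r * k = g ^ t * v] (mod n))"
      using coset_mult_closed_imp_power[of g n v k _ r] \<open>coprime g n\<close> v r(2) by (auto simp: n_def)
    then have "F (r * k) = 0" unfolding F_def n_def using k r(1) by (intro 0) (auto simp: n_def)
    then show ?thesis using conv by (simp add: n_def)
  next
    case False
    then have "F k = 0" unfolding F_def n_def using k by (intro 0) (auto simp: n_def)
    then show ?thesis using conv by (simp add: n_def)
  qed
  moreover have "P ((i0 + r * i0) mod n) \<noteq> 0"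
  proof -
    have "{z \<in> I \<times> I. (fst z + r * snd z) mod n = (i0 + r * i0) mod n} = {(i0, i0)}"
      using r(3) i0 by (auto simp: cong_def I_def n_def)
    then show ?thesis using i0 by (simp add: P_def)
  qed
  ultimately have "min n1 n2 \<le> card {s. s < n1 * n2 \<and> P s \<noteq> 0}"
    using npos by (intro weight_ge_min_if_vanish_on_units[OF \<beta> p(1-3), where ?s0.0 = "(i0 + r * i0) mod n"])
      (auto simp: n_def)
  also have "\<dots> \<le> card ((\<lambda>z. (fst z + r * snd z) mod n) ` (I \<times> I))"
  proof (intro card_mono subsetI)
    fix s assume "s \<in> {s. s < n1 * n2 \<and> P s \<noteq> 0}"
    then have "{z \<in> I \<times> I. (fst z + r * snd z) mod n = s} \<noteq> {}" unfolding P_def by force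
    then show "s \<in> (\<lambda>z. (fst z + r * snd z) mod n) ` (I \<times> I)" by blast
  qed auto
  also have "\<dots> \<le> card (I \<times> I)" by (rule card_image_le) auto
  finally have "min n1 n2 \<le> card I ^ 2" by (simp only: card_cartesian_product power2_eq_square)
  with small show False by linarith
qed


subsection \<open>Whiteman classes as cosets\<close>

text \<open>The order modulo a coprime product is the lcm of the orders \<open>n1 - 1\<close> and
  \<open>n2 - 1\<close>, and their gcd is 6.\<close>

lemma ord_common_primroot:
  assumes "prime n1" "prime n2" "n1 \<noteq> n2" "gcd (n1 - 1) (n2 - 1) = 6"
    and "residue_primroot n1 g" "residue_primroot n2 g"
  shows "ord (n1 * n2) g = (n1 - 1) * (n2 - 1) div 6"
proof -
  have "ord (n1 * n2) g = lcm (n1 - 1) (n2 - 1)"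
    using assms by (simp add: ord_modulus_mult_coprime primes_coprime residue_primroot_def totient_prime)
  then show ?thesis using assms(4) by (simp add: lcm_nat_def)
qed

text \<open>Exponents only matter modulo \<open>ord n g\<close>. This trades the bounded exponents
  of the class for an unrestricted existential, under which closure under multiplication is
  immediate.\<close>

lemma image_power_coset:
  fixes g v n :: nat
  assumes "coprime g n" "n > 1"
  shows "(\<lambda>s. g ^ s * v mod n) ` {..<ord n g} = {k. k < n \<and> (\<exists>s. [k = g ^ s * v] (mod n))}"
proof safe
  fix s show "g ^ s * v mod n < n" using assms by simp
  show "\<exists>t. [g ^ s * v mod n = g ^ t * v] (mod n)" by (rule exI[of _ s]) (simp add: cong_def)
next
  fix k s assume k: "k < n" "[k = g ^ s * v] (mod n)"
  have "[g ^ s = g ^ (s mod ord n g)] (mod n)"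
    using assms order_divides_expdiff[of n g s "s mod ord n g"] by (simp add: cong_def coprime_commute)
  then have "[g ^ s * v = g ^ (s mod ord n g) * v] (mod n)" by (rule cong_scalar_right)
  then have "k = g ^ (s mod ord n g) * v mod n" using k by (simp add: cong_def)
  moreover have "ord n g > 0" using assms by (simp add: ord_eq_0 coprime_commute)
  ultimately show "k \<in> (\<lambda>s. g ^ s * v mod n) ` {..<ord n g}" by auto
qed

lemma card_power_coset:
  fixes g v n :: nat
  assumes "coprime g n" "n > 1" "coprime v n"
  shows "card {k. k < n \<and> (\<exists>s. [k = g ^ s * v] (mod n))} = ord n g"
proof -
  have "inj_on (\<lambda>s. g ^ s * v mod n) {..<ord n g}"
  proof (rule inj_onI)
    fix s t assume st: "s \<in> {..<ord n g}" "t \<in> {..<ord n g}" "g ^ s * v mod n = g ^ t * v mod n"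
    then have "[g ^ s * v = g ^ t * v] (mod n)" by (simp add: cong_def)
    then have "[g ^ s = g ^ t] (mod n)" using assms(3) by (simp add: cong_mult_rcancel_nat)
    then have "[s = t] (mod ord n g)" using order_divides_expdiff assms(1) coprime_commute by metis
    then show "s = t" using st by (simp add: cong_def)
  qed
  then show ?thesis using image_power_coset[OF assms(1,2), of v] by (metis card_image card_lessThan)
qed

text \<open>Classes consist of integers because \<open>u\<close> is one, while exponents of
  \<open>\<beta>\<close> are naturals. The residue \<open>v\<close> of \<open>u ^ j\<close> replaces
  \<open>u\<close>, turning the class into a coset of the powers of \<open>g\<close>.\<close>

lemma bij_nat_whiteman_class:
  assumes "prime n1" "prime n2" "n1 \<noteq> n2" "gcd (n1 - 1) (n2 - 1) = 6"
    and "residue_primroot n1 g" "residue_primroot n2 g"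
    and v: "int v = u ^ j mod int (n1 * n2)"
  shows "bij_betw nat (whiteman_class n1 n2 g u j)
           {k. k < n1 * n2 \<and> (\<exists>s. [k = g ^ s * v] (mod n1 * n2))}"
proof -
  define n where "n = n1 * n2"
  have n: "n > 1" "coprime g n"
    using assms prime_gt_1_nat[of n1] prime_gt_1_nat[of n2]
    by (auto simp: n_def residue_primroot_def coprime_commute intro: one_less_mult)
  have el: "int g ^ s * u ^ j mod int n = int (g ^ s * v mod n)" for s
    using v by (simp add: n_def[symmetric] zmod_int mod_mult_right_eq)
  have eq: "whiteman_class n1 n2 g u j = int ` (\<lambda>s. g ^ s * v mod n) ` {..<ord n g}"
    unfolding whiteman_class_def n_def[symmetric] el
    using ord_common_primroot[OF assms(1-6)] by (auto simp: n_def)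
  have "inj_on nat (whiteman_class n1 n2 g u j)" by (auto simp: eq intro: inj_onI)
  moreover have "nat ` whiteman_class n1 n2 g u j = (\<lambda>s. g ^ s * v mod n) ` {..<ord n g}"
    unfolding eq image_image by simp
  ultimately show ?thesis using image_power_coset[OF n(2,1)] by (simp add: bij_betw_def n_def)
qed

lemma d_ext_eq_prod:
  assumes "prime n1" "prime n2" "n1 \<noteq> n2" "gcd (n1 - 1) (n2 - 1) = 6"
    and "residue_primroot n1 g" "residue_primroot n2 g"
    and "int v = u ^ j mod int (n1 * n2)"
  shows "d_ext n1 n2 g u \<beta> j =
    (\<Prod>k | k < n1 * n2 \<and> (\<exists>s. [k = g ^ s * v] (mod n1 * n2)). [:- (\<beta> ^ k), 1:])"
  unfolding d_ext_def by (rule prod.reindex_bij_betw[OF bij_nat_whiteman_class[OF assms]])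

subsection \<open>Embeddings of finite fields\<close>

text \<open>The library version is stated for class \<open>finite_field\<close>, which is not implied by the sort
  \<open>{finite, field}\<close>.\<close>
lemma power_card_UNIV:
  fixes x :: "'a::{finite,field}"
  shows "x ^ card (UNIV :: 'a set) = x"
proof (cases "x = 0")
  case False
  \<comment> \<open>Multiplication by a nonzero \<open>x\<close> permutes the nonzero
    elements.\<close>
  have "(\<Prod>y\<in>UNIV - {0}. x * y) = \<Prod>(UNIV - {0})"
    by (rule prod.reindex_bij_witness[of _ "\<lambda>y. y / x" "\<lambda>y. x * y"]) (use False in auto)
  then have "x ^ (card (UNIV :: 'a set) - 1) * \<Prod>(UNIV - {0}) = \<Prod>(UNIV - {0} :: 'a set)"
    by (simp add: prod.distrib)
  then have "x ^ (card (UNIV :: 'a set) - 1) = 1" by (simp add: prod_zero_iff)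
  then show ?thesis
    by (metis finite_UNIV_card_ge_0 finite mult.right_neutral power_eq_if not_gr_zero)
qed (simp add: finite_UNIV_card_ge_0)

text \<open>The polynomial \<open>(X + 1)^q - X^q - 1\<close> has degree below \<open>q\<close> and vanishes on the whole field.\<close>
lemma of_nat_binomial_card_eq_0:
  assumes "0 < i" "i < card (UNIV :: 'a::{finite,field} set)"
  shows "of_nat (card (UNIV :: 'a set) choose i) = (0 :: 'a)"
proof -
  define q where "q = card (UNIV :: 'a set)"
  have q: "q > 0" using assms by (simp add: q_def)
  define P where "P = (\<Sum>i\<in>{0<..<q}. Polynomial.monom (of_nat (q choose i) :: 'a) i)"
  have coeff: "Polynomial.coeff P i = (if 0 < i \<and> i < q then of_nat (q choose i) else 0)" for i
    by (simp add: P_def coeff_sum sum.delta)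
  have "poly P x = 0" for x
  proof -
    have "(x + 1) ^ q = (\<Sum>i\<le>q. of_nat (q choose i) * x ^ i)" by (simp add: binomial_ring)
    also have "{..q} = insert 0 (insert q {0<..<q})" using q by auto
    also have "(\<Sum>i\<in>insert 0 (insert q {0<..<q}). of_nat (q choose i) * x ^ i) = 1 + (x ^ q + poly P x)"
      using q by (simp add: P_def poly_sum poly_monom)
    finally show ?thesis using power_card_UNIV[of x] power_card_UNIV[of "x + 1"] by (simp add: q_def)
  qed
  then have roots: "{x. poly P x = 0} = UNIV" by simp
  have "P = 0"
  proof (rule ccontr)
    assume "P \<noteq> 0"
    then have "q \<le> degree P" using card_poly_roots_bound[of P] roots by (simp add: q_def)
    then have "Polynomial.coeff P (degree P) = 0" by (simp add: coeff)
    with \<open>P \<noteq> 0\<close> show False by simp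
  qed
  then show ?thesis using coeff[of i] assms by (simp add: q_def)
qed


text \<open>Interpreted both for \<open>emb\<close> and for the Frobenius power map on the larger
  field, so that one set of transfer rules for polynomials serves both.\<close>

locale field_embedding =
  fixes emb :: "'a::field \<Rightarrow> 'b::field"
  assumes emb_0 [simp]: "emb 0 = 0" and emb_1 [simp]: "emb 1 = 1"
    and emb_add: "emb (x + y) = emb x + emb y" and emb_mult: "emb (x * y) = emb x * emb y"
begin

lemma emb_uminus: "emb (- x) = - emb x"
  using emb_add[of x "- x"] by (simp add: minus_unique)

lemma emb_diff: "emb (x - y) = emb x - emb y"
  using emb_add[of x "- y"] by (simp add: emb_uminus)

lemma emb_sum: "emb (sum f A) = (\<Sum>x\<in>A. emb (f x))"
  by (induction A rule: infinite_finite_induct) (auto simp: emb_add)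

lemma emb_power: "emb (x ^ k) = emb x ^ k"
  by (induction k) (auto simp: emb_mult)

lemma emb_of_nat: "emb (of_nat k) = of_nat k"
  by (induction k) (auto simp: emb_add)

lemma emb_eq_0_iff [simp]: "emb x = 0 \<longleftrightarrow> x = 0"
  using emb_mult[of x "inverse x"] by (cases "x = 0") auto

lemma inj_emb: "inj emb"
  by (rule injI) (metis emb_diff emb_eq_0_iff right_minus_eq)

lemma coeff_map: "Polynomial.coeff (map_poly emb p) i = emb (Polynomial.coeff p i)"
  by (simp add: coeff_map_poly)

lemma map_poly_add: "map_poly emb (p + q) = map_poly emb p + map_poly emb q"
  by (rule poly_eqI) (simp add: coeff_map emb_add)

lemma map_poly_diff: "map_poly emb (p - q) = map_poly emb p - map_poly emb q"
  by (rule poly_eqI) (simp add: coeff_map emb_diff)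

lemma map_poly_mult: "map_poly emb (p * q) = map_poly emb p * map_poly emb q"
  by (rule poly_eqI) (simp add: coeff_map coeff_mult emb_sum emb_mult)

lemma map_poly_prod: "map_poly emb (prod f A) = (\<Prod>x\<in>A. map_poly emb (f x))"
  by (induction A rule: infinite_finite_induct) (auto simp: map_poly_mult)

lemma map_poly_eq_iff: "map_poly emb p = map_poly emb q \<longleftrightarrow> p = q"
  using inj_emb by (auto simp: poly_eq_iff coeff_map inj_eq)

lemma degree_map: "degree (map_poly emb p) = degree p"
  by (rule degree_map_poly) simp

lemma map_poly_linear: "map_poly emb [:a, b:] = [:emb a, emb b:]"
  by (cases "b = 0") (simp_all add: map_poly_pCons)

lemma map_poly_xn1: "map_poly emb (xn1 n) = xn1 n"
  by (simp add: xn1_def map_poly_diff map_poly_monom)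

text \<open>The image of the remainder \<open>f mod d\<close> is divisible by the image of
  \<open>d\<close> but would have smaller degree, so it is zero. Hence a quotient that exists over
  the larger field already comes from the smaller one.\<close>

lemma dvd_and_map_poly_div:
  assumes "map_poly emb d * G = map_poly emb f" "d \<noteq> 0"
  shows "d dvd f" "map_poly emb (f div d) = G"
proof -
  have d: "map_poly emb d \<noteq> 0" using map_poly_eq_iff[of d 0] assms(2) by simp
  have "map_poly emb f = map_poly emb d * map_poly emb (f div d) + map_poly emb (f mod d)"
    by (metis map_poly_add map_poly_mult mult_div_mod_eq)
  then have "map_poly emb (f mod d) = map_poly emb d * (G - map_poly emb (f div d))"
    using assms(1) by (simp add: algebra_simps)
  then have dvd: "map_poly emb d dvd map_poly emb (f mod d)" by simp
  show "d dvd f"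
  proof (rule ccontr)
    assume n: "\<not> d dvd f"
    then have "degree (map_poly emb (f mod d)) < degree (map_poly emb d)"
      using degree_mod_less_degree[OF assms(2)] by (simp add: degree_map)
    moreover have "map_poly emb (f mod d) \<noteq> 0"
      using n map_poly_eq_iff[of "f mod d" 0] by (simp add: dvd_eq_mod_eq_0)
    ultimately show False using dvd_imp_degree_le[OF dvd] by simp
  qed
  then have "map_poly emb d * map_poly emb (f div d) = map_poly emb d * G"
    using assms(1) by (simp flip: map_poly_mult)
  then show "map_poly emb (f div d) = G" using d by simp
qed

end

text \<open>The middle binomial coefficients are zero in the small field, and \<open>emb\<close>
  carries this to the large one, where the binomial theorem leaves only the two outer terms.\<close>

lemma field_embedding_frobenius:
  fixes emb :: "'a::{finite,field} \<Rightarrow> 'b::field"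
  assumes "field_embedding emb"
  shows "field_embedding (\<lambda>x::'b. x ^ card (UNIV :: 'a set))"
proof -
  interpret field_embedding emb by fact
  define q where "q = card (UNIV :: 'a set)"
  have q: "q > 0" by (simp add: q_def finite_UNIV_card_ge_0)
  have "(x + y) ^ q = x ^ q + y ^ q" for x y :: 'b
  proof -
    have "(x + y) ^ q = (\<Sum>i\<le>q. of_nat (q choose i) * x ^ i * y ^ (q - i))" by (rule binomial_ring)
    also have "\<dots> = (\<Sum>i\<in>{0, q}. of_nat (q choose i) * x ^ i * y ^ (q - i))"
    proof (rule sum.mono_neutral_right)
      show "\<forall>i\<in>{..q} - {0, q}. of_nat (q choose i) * x ^ i * y ^ (q - i) = 0"
      proof
        fix i assume "i \<in> {..q} - {0, q}"
        then have "of_nat (q choose i) = (0 :: 'a)"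
          unfolding q_def by (intro of_nat_binomial_card_eq_0) auto
        then show "of_nat (q choose i) * x ^ i * y ^ (q - i) = 0" by (simp flip: emb_of_nat)
      qed
    qed auto
    finally show ?thesis using q by (simp add: add.commute)
  qed
  then show ?thesis using q by unfold_locales (auto simp: q_def power_mult_distrib)
qed

text \<open>The \<open>q\<close> images are fixed by the \<open>q\<close>-th power, and
  \<open>X ^ q - X\<close> has at most \<open>q\<close> roots.\<close>

lemma range_emb_eq_frobenius_fixed:
  fixes emb :: "'a::{finite,field} \<Rightarrow> 'b::field"
  assumes "field_embedding emb"
  shows "range emb = {x. x ^ card (UNIV :: 'a set) = x}"
proof -
  interpret field_embedding emb by fact
  define q where "q = card (UNIV :: 'a set)"
  have "card {0, 1 :: 'a} \<le> q" unfolding q_def by (rule card_mono) auto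
  then have q: "q \<ge> 2" by simp
  define P where "P = Polynomial.monom (1 :: 'b) q - Polynomial.monom 1 1"
  have P: "P \<noteq> 0" "degree P \<le> q"
  proof -
    have "Polynomial.coeff P q = 1" using q by (simp add: P_def)
    then show "P \<noteq> 0" by auto
    show "degree P \<le> q" unfolding P_def using q by (intro degree_diff_le) (auto simp: degree_monom_eq)
  qed
  have roots: "{x. poly P x = 0} = {x. x ^ q = x}" by (auto simp: P_def poly_monom)
  have "card {x :: 'b. x ^ q = x} \<le> card (range emb)"
    using card_poly_roots_bound[OF P(1)] P(2) roots inj_emb by (simp add: card_image q_def)
  moreover have "range emb \<subseteq> {x. x ^ q = x}"
    using power_card_UNIV[where 'a = 'a] by (auto simp: q_def simp flip: emb_power)
  moreover have "finite {x :: 'b. x ^ q = x}" using poly_roots_finite[OF P(1)] roots by simp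
  ultimately show ?thesis unfolding q_def by (intro card_seteq) auto
qed

text \<open>The definite description needs existence and uniqueness. As \<open>q\<close> is a power
  of \<open>g\<close> modulo \<open>n\<close>, multiplication by \<open>q\<close> permutes the
  exponents of the roots, so the Frobenius map fixes every coefficient; uniqueness is injectivity of
  \<open>emb\<close>.\<close>

lemma d_poly_well_defined:
  fixes emb :: "'a::{finite,field} \<Rightarrow> 'b::field"
  assumes emb: "field_embedding emb"
    and D: "d_ext n1 n2 g u \<beta> j = (\<Prod>k | k < n \<and> (\<exists>s. [k = g ^ s * v] (mod n)). [:- (\<beta> ^ k), 1:])"
    and \<beta>: "\<beta> ^ n = 1" and n: "n > 0"
    and q: "[card (UNIV :: 'a set) = g ^ t] (mod n)" "coprime (card (UNIV :: 'a set)) n"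
  shows "map_poly emb (d_poly emb n1 n2 g u \<beta> j) = d_ext n1 n2 g u \<beta> j"
proof -
  interpret field_embedding emb by fact
  define q where "q = card (UNIV :: 'a set)"
  interpret F: field_embedding "\<lambda>x::'b. x ^ card (UNIV :: 'a set)"
    by (rule field_embedding_frobenius[OF emb])
  define K where "K = {k. k < n \<and> (\<exists>s. [k = g ^ s * v] (mod n))}"
  have "finite K" by (simp add: K_def)
  have "inj_on (\<lambda>k. q * k mod n) K"
  proof (rule inj_onI)
    fix a b assume ab: "a \<in> K" "b \<in> K" "q * a mod n = q * b mod n"
    then have "[a = b] (mod n)" using q(2) by (simp add: cong_def[symmetric] cong_mult_lcancel_nat q_def)
    then show "a = b" using ab by (simp add: K_def cong_def)
  qed
  moreover have "(\<lambda>k. q * k mod n) ` K \<subseteq> K"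
  proof
    fix y assume "y \<in> (\<lambda>k. q * k mod n) ` K"
    then obtain k s where k: "y = q * k mod n" "[k = g ^ s * v] (mod n)" by (auto simp: K_def)
    have "[q * k = g ^ t * (g ^ s * v)] (mod n)" using cong_mult[OF q(1) k(2)] by (simp add: q_def)
    then have "[y = g ^ (t + s) * v] (mod n)" using k(1) by (simp add: cong_def power_add mult.assoc)
    then show "y \<in> K" using n k(1) by (auto simp: K_def)
  qed
  ultimately have bij: "bij_betw (\<lambda>k. q * k mod n) K K"
    using \<open>finite K\<close> by (simp add: bij_betw_def endo_inj_surj)
  have modn: "\<beta> ^ (a mod n) = \<beta> ^ a" for a
    by (metis \<beta> mult.left_neutral power_add power_mult power_one mult_div_mod_eq)
  have "map_poly (\<lambda>x. x ^ card (UNIV :: 'a set)) (d_ext n1 n2 g u \<beta> j) = (\<Prod>k\<in>K. [:- (\<beta> ^ (q * k mod n)), 1:])"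
    unfolding D K_def[symmetric] F.map_poly_prod F.map_poly_linear F.emb_uminus modn
    by (simp add: q_def mult.commute flip: power_mult)
  also have "\<dots> = d_ext n1 n2 g u \<beta> j"
    unfolding D K_def[symmetric] by (rule prod.reindex_bij_betw[OF bij])
  finally have fixed: "map_poly (\<lambda>x. x ^ card (UNIV :: 'a set)) (d_ext n1 n2 g u \<beta> j) = d_ext n1 n2 g u \<beta> j" .
  have "Polynomial.coeff (d_ext n1 n2 g u \<beta> j) i \<in> range emb" for i
    using F.coeff_map[of "d_ext n1 n2 g u \<beta> j" i]
    unfolding range_emb_eq_frobenius_fixed[OF emb] fixed by simp
  \<comment> \<open>The coefficient rule for \<open>map_poly\<close> requires a function that sends
    0 to 0.\<close>
  moreover have "inv_into UNIV emb 0 = 0" using inv_f_f[OF inj_emb, of 0] by simp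
  ultimately have eq: "map_poly emb (map_poly (inv_into UNIV emb) (d_ext n1 n2 g u \<beta> j)) = d_ext n1 n2 g u \<beta> j"
    by (intro poly_eqI) (simp add: coeff_map coeff_map_poly f_inv_into_f)
  show ?thesis unfolding d_poly_def using eq by (rule theI) (metis eq map_poly_eq_iff)
qed

text \<open>Both sides are monic of degree \<open>n\<close> and agree at the \<open>n\<close>
  distinct powers of \<open>\<beta>\<close>.\<close>

lemma prod_powers_eq_xn1:
  fixes \<beta> :: "'b::field"
  assumes \<beta>: "\<And>k. \<beta> ^ k = 1 \<longleftrightarrow> n dvd k" and n: "n > 0"
  shows "(\<Prod>k<n. [:- (\<beta> ^ k), 1:]) = xn1 n"
proof -
  let ?P = "\<Prod>k<n. [:- (\<beta> ^ k), 1:]"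
  have deg: "degree ?P = n" by (subst degree_prod_sum_eq) auto
  have "lead_coeff ?P = 1" by (simp add: lead_coeff_prod)
  show ?thesis
  proof (rule poly_eqI_degree_lead_coeff)
    show "Polynomial.coeff ?P n = Polynomial.coeff (xn1 n) n"
      using \<open>lead_coeff ?P = 1\<close> deg n by (simp add: xn1_def)
    show "n \<le> card ((\<lambda>k. \<beta> ^ k) ` {..<n})" using inj_on_powers[OF \<beta> n] by (simp add: card_image)
    show "degree (xn1 n :: 'b poly) \<le> n"
      unfolding xn1_def by (intro degree_diff_le) (auto simp: degree_monom_eq)
    fix z assume "z \<in> (\<lambda>k. \<beta> ^ k) ` {..<n}"
    then obtain k where k: "k < n" "z = \<beta> ^ k" by blast
    then have "poly ?P z = 0" by (auto simp: poly_prod)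
    moreover have "z ^ n = 1" using k \<beta> by (simp flip: power_mult)
    ultimately show "poly ?P z = poly (xn1 n) z" by (simp add: xn1_def poly_monom)
  qed (use deg in simp)
qed


subsection \<open>Cyclic codes\<close>

lemma degree_xn1: "n > 0 \<Longrightarrow> degree (xn1 n :: 'a::field poly) = n"
  unfolding xn1_def diff_conv_add_uminus by (subst degree_add_eq_left) (auto simp: degree_monom_eq)

lemma xn1_nonzero: "n > 0 \<Longrightarrow> xn1 n \<noteq> (0 :: 'a::field poly)"
  using degree_xn1[of n, where 'a = 'a] by auto

text \<open>Reducing \<open>a * gen\<close> modulo \<open>gen * h\<close> gives
  \<open>gen * (a mod h)\<close>, so the multiples \<open>gen * x ^ i\<close> with
  \<open>i < degree h\<close> form a basis.\<close>

lemma code_dim_cyclic_code: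
  fixes gen h :: "'a::field poly"
  assumes gh: "xn1 n = gen * h" and n: "n > 0"
  shows "code_dim (cyclic_code n gen) = degree h"
proof -
  interpret V: vector_space "Polynomial.smult :: 'a \<Rightarrow> 'a poly \<Rightarrow> 'a poly"
    by unfold_locales (simp_all add: smult_add_right smult_add_left)
  have nz: "gen \<noteq> 0" "h \<noteq> 0" using gh degree_xn1[OF n, where 'a = 'a] n by auto
  define B where "B = (\<lambda>i. gen * Polynomial.monom 1 i) ` {..<degree h}"
  have inj: "inj_on (\<lambda>i. gen * Polynomial.monom 1 i) {..<degree h}"
    by (rule inj_onI) (use nz in \<open>auto simp: monom_eq_iff'\<close>)
  have comb: "(\<Sum>i<degree h. Polynomial.smult (f i) (gen * Polynomial.monom 1 i))
      = gen * (\<Sum>i<degree h. Polynomial.monom (f i) i)" for f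
    by (simp add: sum_distrib_left smult_monom flip: mult_smult_right)
  have "V.dim (cyclic_code n gen) = degree h"
  proof (rule V.dim_unique)
    show "card B = degree h" unfolding B_def by (simp add: card_image inj)
    show "B \<subseteq> cyclic_code n gen"
    proof
      fix b assume "b \<in> B"
      then obtain i where i: "i < degree h" "b = gen * Polynomial.monom 1 i" by (auto simp: B_def)
      have "degree b < degree (xn1 n :: 'a poly)"
        using i nz by (simp add: gh degree_mult_eq degree_monom_eq)
      then have "b = (Polynomial.monom 1 i * gen) mod xn1 n"
        using i(2) by (simp add: mod_poly_less mult.commute)
      then show "b \<in> cyclic_code n gen" unfolding cyclic_code_def by blast
    qed
    show "V.independent B"
    proof (rule V.independent_if_scalars_zero)
      fix f x assume 0: "(\<Sum>x\<in>B. Polynomial.smult (f x) x) = 0" and "x \<in> B"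
      then obtain j where j: "j < degree h" "x = gen * Polynomial.monom 1 j" by (auto simp: B_def)
      let ?f = "\<lambda>i. f (gen * Polynomial.monom 1 i)"
      have "gen * (\<Sum>i<degree h. Polynomial.monom (?f i) i) = 0"
        using 0 unfolding B_def by (simp add: sum.reindex[OF inj] comb)
      then have "(\<Sum>i<degree h. Polynomial.monom (?f i) i) = 0" using nz by simp
      then have "Polynomial.coeff (\<Sum>i<degree h. Polynomial.monom (?f i) i) j = 0" by simp
      then show "f x = 0" using j by (simp add: coeff_sum sum.delta)
    qed (simp add: B_def)
    show "cyclic_code n gen \<subseteq> V.span B"
    proof
      fix c assume "c \<in> cyclic_code n gen"
      then obtain a where "c = (a * gen) mod xn1 n" by (auto simp: cyclic_code_def)
      then have c: "c = gen * (a mod h)" by (simp only: gh mult_mod_right mult.commute[of a gen])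
      have eq: "a mod h = (\<Sum>i<degree h. Polynomial.monom (Polynomial.coeff (a mod h) i) i)"
      proof (rule poly_eqI)
        fix i show "Polynomial.coeff (a mod h) i =
            Polynomial.coeff (\<Sum>i<degree h. Polynomial.monom (Polynomial.coeff (a mod h) i) i) i"
          using degree_mod_less[OF nz(2), of a] by (auto simp: coeff_sum sum.delta intro: coeff_eq_0)
      qed
      then have "c = (\<Sum>i<degree h. Polynomial.smult (Polynomial.coeff (a mod h) i) (gen * Polynomial.monom 1 i))"
        unfolding comb using c by (simp flip: eq)
      also have "\<dots> \<in> V.span B"
        by (intro V.span_sum V.span_scale V.span_base) (auto simp: B_def)
      finally show "c \<in> V.span B" .
    qed
  qed
  then show ?thesis by (simp add: code_dim_def)
qed

text \<open>The code is closed under differences, so every distance between distinct codewords is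
  the weight of a nonzero codeword.\<close>

lemma min_distance_cyclic_code_ge:
  fixes gen :: "'a::field poly"
  assumes w: "\<And>c. c \<in> cyclic_code n gen \<Longrightarrow> c \<noteq> 0 \<Longrightarrow> d \<le> card {i. i < n \<and> Polynomial.coeff c i \<noteq> 0}"
    and nz: "gen mod xn1 n \<noteq> 0"
  shows "d \<le> min_distance n (cyclic_code n gen)"
proof -
  let ?C = "cyclic_code n gen"
  let ?D = "{hamming_dist n c c' | c c'. c \<in> ?C \<and> c' \<in> ?C \<and> c \<noteq> c'}"
  have diff: "c - c' \<in> ?C" if c: "c \<in> ?C" "c' \<in> ?C" for c c'
  proof -
    obtain a a' where "c = (a * gen) mod xn1 n" "c' = (a' * gen) mod xn1 n"
      using c by (auto simp: cyclic_code_def)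
    then have "c - c' = ((a - a') * gen) mod xn1 n" by (simp add: poly_mod_diff_left left_diff_distrib)
    then show ?thesis by (auto simp: cyclic_code_def)
  qed
  have "?D \<subseteq> {..n}"
  proof safe
    fix c c' :: "'a poly"
    show "hamming_dist n c c' \<le> n"
      unfolding hamming_dist_def using card_mono[of "{..<n}" "{i. i < n \<and> Polynomial.coeff c i \<noteq> Polynomial.coeff c' i}"]
      by auto
  qed
  then have fin: "finite ?D" using finite_subset by blast
  \<comment> \<open>Two distinct codewords, so that \<open>Min\<close> ranges over a nonempty
    set.\<close>
  have "0 \<in> ?C" "gen mod xn1 n \<in> ?C"
    unfolding cyclic_code_def by (auto intro: exI[of _ 0] exI[of _ 1])
  then have "hamming_dist n (gen mod xn1 n) 0 \<in> ?D" using nz by blast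
  then have "?D \<noteq> {}" by blast
  moreover have "d \<le> hamming_dist n c c'" if "c \<in> ?C" "c' \<in> ?C" "c \<noteq> c'" for c c'
    using w[OF diff[OF that(1,2)]] that(3) by (simp add: hamming_dist_def)
  ultimately show ?thesis unfolding min_distance_def using fin by (subst Min_ge_iff) auto
qed

text \<open>Numerator and denominator of the generator have \<open>\<beta> ^ 0\<close> as a double zero; all other zeros are simple,
  so the quotient has the zeros \<open>\<beta> ^ k\<close> with \<open>k\<close> a unit outside \<open>K\<close>.\<close>
lemma generator_factorization:
  fixes \<beta> :: "'b::field"
  assumes \<beta>: "\<And>k. \<beta> ^ k = 1 \<longleftrightarrow> n1 * n2 dvd k"
    and p: "prime n1" "prime n2" "n1 \<noteq> n2"
    and K: "K \<subseteq> {k. k < n1 * n2 \<and> coprime k (n1 * n2)}"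
  shows "xn1 n1 * xn1 n2 * (\<Prod>k\<in>K. [:- (\<beta> ^ k), 1:]) *
           (\<Prod>k\<in>{k. k < n1 * n2 \<and> coprime k (n1 * n2)} - K. [:- (\<beta> ^ k), 1:]) = xn1 (n1 * n2) * [:-1, 1:]"
proof -
  define n where "n = n1 * n2"
  define L where "L k = [:- (\<beta> ^ k), 1:]" for k
  define U where "U = {k. k < n \<and> coprime k n}"
  define A where "A m = {k. k < n \<and> m dvd k}" for m
  have pos: "n1 > 0" "n2 > 0" "n > 0" using p by (simp_all add: prime_gt_0_nat n_def)
  have fin: "finite U" "finite (A m)" for m by (simp_all add: U_def A_def)
  \<comment> \<open>The roots of \<open>x ^ m - 1\<close> are the powers of
    \<open>\<beta> ^ m'\<close>, so the index swaps: \<open>xn1 n1\<close> belongs to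
    \<open>A n2\<close> and \<open>xn1 n2\<close> to \<open>A n1\<close>.\<close>
  have mult: "xn1 m = prod L (A m')" if m: "n = m' * m" "m > 0" "m' > 0" for m m'
  proof -
    have "xn1 m = (\<Prod>k<m. [:- ((\<beta> ^ m') ^ k), 1:])"
      using m \<beta> by (intro prod_powers_eq_xn1[symmetric]) (simp_all add: n_def flip: power_mult)
    also have "\<dots> = prod L ((\<lambda>k. m' * k) ` {..<m})"
      using m by (subst prod.reindex) (auto simp: L_def power_mult inj_on_def)
    also have "(\<lambda>k. m' * k) ` {..<m} = A m'" using m by (auto simp: A_def)
    finally show ?thesis .
  qed
  have un: "{..<n} = U \<union> (A n1 \<union> A n2)" "U \<inter> (A n1 \<union> A n2) = {}"
  proof -
    have "coprime k n \<longleftrightarrow> \<not> (n1 dvd k \<or> n2 dvd k)" for k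
      using p by (metis coprime_commute coprime_mult_right_iff n_def prime_imp_coprime
          coprime_absorb_left not_prime_unit)
    then show "{..<n} = U \<union> (A n1 \<union> A n2)" "U \<inter> (A n1 \<union> A n2) = {}"
      by (auto simp: U_def A_def)
  qed
  have int: "A n1 \<inter> A n2 = {0}"
  proof -
    have "n dvd k" if "n1 dvd k" "n2 dvd k" for k
      using that p divides_mult primes_coprime unfolding n_def by blast
    then show ?thesis using pos nat_dvd_not_less[of _ n] by (auto simp: A_def)
  qed
  have "xn1 n = prod L {..<n}" unfolding L_def using \<beta> pos by (intro prod_powers_eq_xn1[symmetric]) (simp_all add: n_def)
  also have "\<dots> = prod L U * prod L (A n1 \<union> A n2)"
    unfolding un(1) using fin un(2) by (intro prod.union_disjoint) auto
  \<comment> \<open>Passing from the union to the two sets separately costs the factor of their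
    overlap \<open>k = 0\<close>, which is \<open>x - 1\<close>.\<close>
  finally have "xn1 n * prod L (A n1 \<inter> A n2) = prod L U * (prod L (A n1) * prod L (A n2))"
    using prod.union_inter[of "A n1" "A n2" L] fin by (simp add: mult.assoc)
  moreover have "prod L U = prod L K * prod L (U - K)"
    using prod.subset_diff[of K U L] K fin by (simp add: U_def n_def mult.commute)
  moreover have "xn1 n1 = prod L (A n2)" "xn1 n2 = prod L (A n1)"
    using pos by (auto intro!: mult simp: n_def)
  ultimately show ?thesis
    by (simp add: int L_def U_def n_def mult_ac)
qed

text \<open>Let \<open>N = card UNIV - 1\<close>. If \<open>\<alpha> ^ m = 1\<close> with
  \<open>0 < m < N\<close>, there would be at most \<open>m\<close> powers of
  \<open>\<alpha>\<close>, too few to fill the \<open>N\<close> nonzero elements. So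
  \<open>\<alpha>\<close> has order \<open>N\<close>, and its power with exponent
  \<open>N div n\<close> has order \<open>n\<close>.\<close>

lemma order_of_generator_power:
  fixes \<alpha> :: "'b::{finite,field}"
  assumes \<alpha>: "{\<alpha> ^ k | k. True} = UNIV - {0}" and n: "n dvd card (UNIV :: 'b set) - 1"
  shows "(\<alpha> ^ ((card (UNIV :: 'b set) - 1) div n)) ^ k = 1 \<longleftrightarrow> n dvd k"
proof -
  define N where "N = card (UNIV :: 'b set) - 1"
  have "card {0, 1 :: 'b} \<le> card (UNIV :: 'b set)" by (rule card_mono) auto
  then have N: "N > 0" by (simp add: N_def)
  have "\<alpha> \<in> {\<alpha> ^ k | k. True}" by (auto intro: exI[of _ 1])
  then have "\<alpha> \<noteq> 0" using \<alpha> by blast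
  have aN: "\<alpha> ^ N = 1"
  proof -
    have "\<alpha> ^ N * \<alpha> = \<alpha>" using power_card_UNIV[of \<alpha>] N by (simp add: N_def power_eq_if)
    then show ?thesis using \<open>\<alpha> \<noteq> 0\<close> by simp
  qed
  have red: "\<alpha> ^ k = \<alpha> ^ (k mod m)" if "\<alpha> ^ m = 1" for k m
    by (metis that mult.left_neutral power_add power_mult power_one mult_div_mod_eq)
  have ord: "\<alpha> ^ k = 1 \<longleftrightarrow> N dvd k" for k
  proof
    assume k: "\<alpha> ^ k = 1"
    show "N dvd k"
    proof (rule ccontr)
      assume "\<not> N dvd k"
      define m where "m = k mod N"
      have m: "0 < m" "m < N" using \<open>\<not> N dvd k\<close> N by (simp_all add: m_def dvd_eq_mod_eq_0)
      have "\<alpha> ^ m = 1" using red[OF aN, of k] k by (simp add: m_def)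
      have "{\<alpha> ^ k | k. True} \<subseteq> (\<lambda>k. \<alpha> ^ k) ` {..<m}"
      proof safe
        fix k show "\<alpha> ^ k \<in> (\<lambda>k. \<alpha> ^ k) ` {..<m}"
          using red[OF \<open>\<alpha> ^ m = 1\<close>, of k] m(1) by (intro image_eqI[of _ _ "k mod m"]) auto
      qed
      then have "card (UNIV - {0 :: 'b}) \<le> card {..<m}" unfolding \<alpha> by (intro surj_card_le) auto
      then show False using m by (simp add: N_def card_Diff_singleton)
    qed
  qed (auto simp: power_mult aN elim!: dvdE)
  obtain l where l: "N = n * l" using n by (auto simp: N_def)
  then have "N div n = l" "n > 0" "l > 0" using N by auto
  then show ?thesis
    unfolding N_def[symmetric] using ord[of "l * k"] l by (simp flip: power_mult)
qed


section \<open>Assembly of dimension and distance\<close>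

theorem theorem6:
  fixes n1 n2 g :: nat and u :: int and j :: nat
    and emb :: "'a::{finite,field} \<Rightarrow> 'b::{finite,field}" and \<alpha> :: 'b
  assumes "prime n1" "prime n2" "odd n1" "odd n2" "n1 \<noteq> n2"
    and "gcd (n1 - 1) (n2 - 1) = 6"
    and "residue_primroot n1 g" "residue_primroot n2 g"
    and "[u = int g] (mod int n1)" "[u = 1] (mod int n2)"
    and "coprime (card (UNIV :: 'a set)) (n1 * n2)"
    and "int (card (UNIV :: 'a set)) mod int (n1 * n2) \<in> whiteman_class n1 n2 g u 0"
    and "card (UNIV :: 'b set) = card (UNIV :: 'a set) ^ ord (n1 * n2) (card (UNIV :: 'a set))"
    and "emb 0 = 0" "emb 1 = 1" "\<And>x y. emb (x + y) = emb x + emb y"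
    and "\<And>x y. emb (x * y) = emb x * emb y"
    and "{\<alpha> ^ k | k. True} = UNIV - {0}"
    and "j \<le> 5"
  shows
    "let n = n1 * n2;
         \<beta> = \<alpha> ^ ((card (UNIV :: 'b set) - 1) div n);
         gen = (xn1 n * [:-1, 1:]) div (xn1 n1 * xn1 n2 * d_poly emb n1 n2 g u \<beta> j);
         C = cyclic_code n gen
     in code_dim C = n1 + n2 - 1 + (n1 - 1) * (n2 - 1) div 6
        \<and> \<lceil>sqrt (real (min n1 n2))\<rceil> \<le> int (min_distance n C)"
proof -
  define n where "n = n1 * n2"
  define q where "q = card (UNIV :: 'a set)"
  define e where "e = (n1 - 1) * (n2 - 1) div 6"
  define \<beta> where "\<beta> = \<alpha> ^ ((card (UNIV :: 'b set) - 1) div n)"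
  define v where "v = nat (u ^ j mod int n)"
  define dp where "dp = d_poly emb n1 n2 g u \<beta> j"
  define gen where "gen = (xn1 n * [:-1, 1:]) div (xn1 n1 * xn1 n2 * dp)"
  note p = \<open>prime n1\<close> \<open>prime n2\<close> \<open>n1 \<noteq> n2\<close>
  note g = \<open>residue_primroot n1 g\<close> \<open>residue_primroot n2 g\<close>
  note gcd = \<open>gcd (n1 - 1) (n2 - 1) = 6\<close>
  have emb: "field_embedding emb" by unfold_locales (fact assms)+
  interpret field_embedding emb by (fact emb)
  have six: "6 dvd n1 - 1" "6 dvd n2 - 1" by (metis gcd gcd_dvd1, metis gcd gcd_dvd2)
  have n1: "n1 > 1" "n2 > 1" using p(1,2) by (auto dest: prime_gt_1_nat)
  then have n: "n > 1" unfolding n_def by (rule less_1_mult)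
  then have n0: "n > 0" by simp
  have gn: "coprime g n" using g by (simp add: n_def residue_primroot_def coprime_commute)
  have qn: "coprime q n" using assms(11) by (simp add: q_def n_def)
  have v: "int v = u ^ j mod int (n1 * n2)" unfolding n_def[symmetric] v_def using n0 by simp
  have "coprime (int g) (int n1)" using g by (simp add: residue_primroot_def coprime_commute)
  then have "coprime u (int n1)" using cong_imp_coprime[OF cong_sym[OF assms(9)]] by simp
  moreover have "coprime u (int n2)" using cong_imp_coprime[OF cong_sym[OF assms(10)]] by simp
  ultimately have "coprime (u ^ j) (int n)" by (simp add: n_def)
  then have "coprime (int v) (int n)" unfolding v[folded n_def] using n0 by simp
  then have vn: "coprime v n" by simp
  have "n dvd card (UNIV :: 'b set) - 1"
  proof -
    have "[q ^ ord n q = 1] (mod n)" by (rule ord)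
    then show ?thesis unfolding assms(13) q_def n_def by (rule cong_to_1_nat)
  qed
  then have \<beta>: "\<beta> ^ k = 1 \<longleftrightarrow> n1 * n2 dvd k" for k
    unfolding \<beta>_def n_def using order_of_generator_power assms(18) by blast
  obtain t where "int q mod int n = (int g ^ t * u ^ 0) mod int n"
    using assms(12) by (auto simp: whiteman_class_def q_def n_def)
  then have "[int q = int (g ^ t)] (mod int n)" by (simp add: cong_def)
  then have qt: "[q = g ^ t] (mod n)" by (simp only: cong_int_iff)
  define K where "K = {k. k < n \<and> (\<exists>s. [k = g ^ s * v] (mod n))}"
  define U where "U = {k. k < n \<and> coprime k n}"
  define L where "L k = [:- (\<beta> ^ k), 1:]" for k
  have D: "d_ext n1 n2 g u \<beta> j = prod L K"
    unfolding L_def K_def n_def by (rule d_ext_eq_prod[OF p gcd g v])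
  have mdp: "map_poly emb dp = prod L K"
    unfolding dp_def D[symmetric] using D \<beta> n0 qt qn
    by (intro d_poly_well_defined[OF emb]) (auto simp: L_def K_def n_def q_def)
  have KU: "K \<subseteq> U"
  proof
    fix k assume "k \<in> K"
    then obtain s where k: "k < n" "[g ^ s * v = k] (mod n)" by (auto simp: K_def intro: cong_sym)
    have "coprime (g ^ s * v) n" using gn vn by simp
    then have "coprime k n" by (rule cong_imp_coprime[OF k(2)])
    with k(1) show "k \<in> U" by (simp add: U_def)
  qed
  have fin: "finite U" "finite K" by (simp_all add: U_def K_def)
  have "ord n g = e" unfolding n_def e_def by (rule ord_common_primroot[OF p gcd g])
  then have cK: "card K = e" unfolding K_def using card_power_coset[OF gn n vn] by simp
  have e: "(n1 - 1) * (n2 - 1) = 6 * e" using six by (simp add: e_def dvd_mult2)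
  \<comment> \<open>\<open>U\<close> runs over \<open>0..n-1\<close> and \<open>totatives n\<close>
    over \<open>1..n\<close>; they agree because neither 0 nor \<open>n\<close> is coprime to
    \<open>n > 1\<close>.\<close>
  have "U = totatives n"
    using n by (auto simp: U_def totatives_def le_less intro: gr0I)
  then have cU: "card U = 6 * e"
    using e p by (simp add: totient_def[symmetric] n_def totient_mult_coprime primes_coprime totient_prime)
  have cUK: "card (U - K) = 5 * e" using cU cK KU fin by (simp add: card_Diff_subset)
  \<comment> \<open>The factorization over the large field descends: the roots of \<open>gen\<close>
    turn out to be the \<open>\<beta> ^ k\<close> with \<open>k\<close> a unit outside
    \<open>K\<close>.\<close>
  have "map_poly emb (xn1 n1 * xn1 n2 * dp) * prod L (U - K) = map_poly emb (xn1 n * [:-1, 1:])"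
    using generator_factorization[OF \<beta> p KU[unfolded U_def n_def]]
    by (simp only: map_poly_mult map_poly_xn1 map_poly_linear emb_uminus emb_1 mdp L_def[abs_def] U_def n_def)
  moreover have "dp \<noteq> 0" using mdp fin by (auto simp: L_def)
  then have "xn1 n1 * xn1 n2 * dp \<noteq> 0" using n1 xn1_nonzero[of n1, where 'a = 'a] xn1_nonzero[of n2, where 'a = 'a] by simp
  ultimately have mgen: "map_poly emb gen = prod L (U - K)"
    unfolding gen_def by (rule dvd_and_map_poly_div)
  have dgen: "degree gen = 5 * e"
    unfolding degree_map[symmetric] mgen by (subst degree_prod_sum_eq) (auto simp: L_def cUK)
  have gen0: "gen \<noteq> 0" using mgen fin by (auto simp: L_def)
  have "prod L {..<n} = prod L ({..<n} - (U - K)) * prod L (U - K)"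
    by (rule prod.subset_diff) (auto simp: U_def)
  moreover have "prod L {..<n} = xn1 n"
    unfolding L_def by (rule prod_powers_eq_xn1[OF \<beta>[folded n_def] n0])
  ultimately have "map_poly emb gen * prod L ({..<n} - (U - K)) = map_poly emb (xn1 n)"
    by (simp add: mgen map_poly_xn1 mult.commute)
  then have "gen dvd xn1 n" using gen0 by (rule dvd_and_map_poly_div)
  then obtain h where h: "xn1 n = gen * h" by (elim dvdE)
  then have "h \<noteq> 0" using xn1_nonzero[OF n0, where 'a = 'a] by auto
  then have "n = 5 * e + degree h"
    using degree_xn1[OF n0, where 'a = 'a] gen0 by (simp add: h degree_mult_eq dgen)
  \<comment> \<open>This is \<open>n = (n1 - 1) * (n2 - 1) + n1 + n2 - 1\<close>, written without
    subtraction.\<close>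
  moreover have "n + 1 = n1 + n2 + 6 * e"
    using e[symmetric] n1 by (cases n1; cases n2) (auto simp: n_def)
  ultimately have deg: "degree h = n1 + n2 - 1 + e" "5 * e < n" using n1 by linarith+
  have dim: "code_dim (cyclic_code n gen) = n1 + n2 - 1 + e"
    using code_dim_cyclic_code[OF h n0] deg by simp
  have weight: "nat \<lceil>sqrt (real (min n1 n2))\<rceil> \<le> card {i. i < n \<and> Polynomial.coeff c i \<noteq> 0}"
    if "c \<in> cyclic_code n gen" "c \<noteq> 0" for c
  proof -
    obtain a where "c = (a * gen) mod xn1 n" using \<open>c \<in> _\<close> by (auto simp: cyclic_code_def)
    then have c: "c = gen * (a mod h)" by (simp only: h mult_mod_right mult.commute[of a gen])
    have degc: "degree c < n"
      using degree_mod_less'[of "xn1 n :: 'a poly" "a * gen"] degree_xn1[OF n0, where 'a = 'a] \<open>c = (a * gen) mod xn1 n\<close> \<open>c \<noteq> 0\<close> xn1_nonzero[OF n0, where 'a = 'a]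
      by simp
    obtain i0 where i0: "Polynomial.coeff c i0 \<noteq> 0" using \<open>c \<noteq> 0\<close> by (metis leading_coeff_0_iff)
    then have "i0 < n" using degc le_degree by fastforce
    have eval: "(\<Sum>i<n. emb (Polynomial.coeff c i) * x ^ i) = poly (map_poly emb c) x" for x
      unfolding poly_altdef coeff_map degree_map using degc
      by (intro sum.mono_neutral_right) (auto simp: coeff_eq_0)
    have "min n1 n2 \<le> card {i. i < n1 * n2 \<and> emb (Polynomial.coeff c i) \<noteq> 0} ^ 2"
    proof (rule min_le_weight_square[OF \<beta> p six g])
      show "coprime v (n1 * n2)" using vn by (simp add: n_def)
      show "i0 < n1 * n2" "emb (Polynomial.coeff c i0) \<noteq> 0" using i0 \<open>i0 < n\<close> by (simp_all add: n_def)
      fix k assume k: "coprime k (n1 * n2)" "\<not> (\<exists>s. [k = g ^ s * v] (mod n1 * n2))"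
      \<comment> \<open>\<open>k\<close> is an arbitrary unit outside the coset; its residue indexes
        a root of \<open>gen\<close>, hence of the multiple \<open>c\<close>.\<close>
      have "k mod n \<in> U - K" using k[folded n_def] n0 by (auto simp: U_def K_def)
      then have "poly (prod L (U - K)) (\<beta> ^ (k mod n)) = 0"
        using fin by (auto simp: poly_prod L_def)
      moreover have "\<beta> ^ (k mod n) = \<beta> ^ k"
      proof -
        have "\<beta> ^ k = \<beta> ^ (n * (k div n) + k mod n)" by simp
        also have "\<dots> = \<beta> ^ (k mod n)" unfolding power_add using \<beta>[of "n * (k div n)"] by (simp add: n_def)
        finally show ?thesis by simp
      qed
      ultimately have "poly (map_poly emb c) (\<beta> ^ k) = 0" by (simp add: c map_poly_mult mgen)
      then show "(\<Sum>i<n1 * n2. emb (Polynomial.coeff c i) * \<beta> ^ (i * k)) = 0"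
        using eval[of "\<beta> ^ k"] by (simp add: n_def mult.commute flip: power_mult)
    qed
    then have "real (min n1 n2) \<le> real (card {i. i < n \<and> Polynomial.coeff c i \<noteq> 0}) ^ 2"
      by (simp only: n_def emb_eq_0_iff flip: of_nat_power of_nat_le_iff)
    then have "sqrt (real (min n1 n2)) \<le> real (card {i. i < n \<and> Polynomial.coeff c i \<noteq> 0})"
      by (intro real_le_lsqrt) auto
    then show ?thesis by (simp add: ceiling_le_iff nat_le_iff)
  qed
  \<comment> \<open>The degree \<open>5 * e\<close> of \<open>gen\<close> is below \<open>n\<close>,
    so \<open>gen\<close> is itself a nonzero codeword and the minimum distance is taken over a
    nonempty set.\<close>
  have "gen mod xn1 n = gen"
    using deg(2) dgen degree_xn1[OF n0, where 'a = 'a] by (intro mod_poly_less) simp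
  then have "nat \<lceil>sqrt (real (min n1 n2))\<rceil> \<le> min_distance n (cyclic_code n gen)"
    using gen0 by (intro min_distance_cyclic_code_ge weight) auto
  then show ?thesis
    using dim by (simp add: Let_def nat_le_iff gen_def dp_def \<beta>_def n_def e_def)
qed

end
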